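(* For every integer $k\ge 1$ there exists a bijection $\phi_{\mathrm{squ}}$ from the set of tree-like polyominoes of size $k$ to the set of saturated tree-like polyominoes of size $4k+1$.
   Context: The square lattice is the simple graph on $\mathbb{Z}^2$ in which two points are adjacent iff their Euclidean distance is $1$. A tree-like polyomino of size $n$ is a subgraph of the square lattice induced by a set of $n$ vertices which is a tree; polyominoes are considered up to translation (fixed polyominoes). $n(T)$ is the number of vertices of $T$ and $n_1(T)$ is the number of vertices of degree $1$ (leaves). $L_{\mathrm{squ}}(n)$ is the maximum of $n_1(T)$ over all tree-like polyominoes of size $n\ge 2$; $T$ is fully leafed if $n_1(T)=L_{\mathrm{squ}}(n(T))$. A fully leafed tree-like polyomino $T$ is called saturated if $n_1(T)\ge \overline{L}_{\mathrm{squ}}(n(T))$, where $\overline{L}_{\mathrm{squ}}(n)=\frac{n+3}{2}$. *)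

theory Defs
  imports "HOL-Analysis.Product_Vector" "Graph_Theory.Graph_Theory"
begin

text \<open>
  Undirected simple graphs are represented, as in Graph_Theory, by symmetric loop-free digraphs:
  an edge between u and v is the pair of arcs (u, v) and (v, u).
\<close>

definition lattice_dist :: "int \<times> int \<Rightarrow> int \<times> int \<Rightarrow> real" where
  "lattice_dist p q =
     dist (real_of_int (fst p), real_of_int (snd p)) (real_of_int (fst q), real_of_int (snd q))"

definition square_lattice :: "(int \<times> int) pair_pre_digraph" where
  "square_lattice = \<lparr> pverts = UNIV, parcs = {(p, q). lattice_dist p q = 1} \<rparr>"

text \<open>
  The constant \<^const>\<open>Digraph_Component.tree\<close> does not apply to symmetric digraphs, because
  \<^const>\<open>pre_digraph.cycle\<close> admits the walk u, v, u along a single edge. The cycles of an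
  undirected simple graph are those of length at least 3.
\<close>

definition undirected_tree :: "('a, 'b) pre_digraph \<Rightarrow> bool" where
  "undirected_tree G \<longleftrightarrow>
     Digraph_Component.connected G \<and> \<not> (\<exists>p. pre_digraph.cycle G p \<and> length p \<ge> 3)"

text \<open>
  An induced subgraph of the lattice is determined by its vertex set, so a polyomino
  (before passing to translation classes) is given by its set S of vertices.
\<close>

definition lattice_subgraph :: "(int \<times> int) set \<Rightarrow> (int \<times> int, (int \<times> int) \<times> (int \<times> int)) pre_digraph"
  where "lattice_subgraph S = with_proj square_lattice \<restriction> S"

definition tree_like :: "(int \<times> int) set \<Rightarrow> bool" where
  "tree_like S \<longleftrightarrow> finite S \<and> undirected_tree (lattice_subgraph S)"

text \<open>In a symmetric digraph the out-degree is the degree of the undirected graph.\<close>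

definition num_leaves :: "(int \<times> int) set \<Rightarrow> nat" where
  "num_leaves S = card {v \<in> S. out_degree (lattice_subgraph S) v = 1}"

definition L_squ :: "nat \<Rightarrow> nat" where
  "L_squ n = Max {num_leaves S | S. tree_like S \<and> card S = n}"

definition fully_leafed :: "(int \<times> int) set \<Rightarrow> bool" where
  "fully_leafed S \<longleftrightarrow> tree_like S \<and> num_leaves S = L_squ (card S)"

definition L_squ_bar :: "nat \<Rightarrow> real" where
  "L_squ_bar n = (real n + 3) / 2"

definition saturated :: "(int \<times> int) set \<Rightarrow> bool" where
  "saturated S \<longleftrightarrow> fully_leafed S \<and> real (num_leaves S) \<ge> L_squ_bar (card S)"

definition translation_rel :: "((int \<times> int) set) rel" where
  "translation_rel = {(S, T). \<exists>v. T = (\<lambda>p. p + v) ` S}"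

lemma equiv_translation_rel: "equiv UNIV translation_rel"
proof (rule equivI)
  show "translation_rel \<subseteq> UNIV \<times> UNIV" by simp
  show "refl translation_rel"
  proof (rule refl_onI)
    fix S :: "(int \<times> int) set"
    have "S = (\<lambda>p. p + 0) ` S" by simp
    then show "(S, S) \<in> translation_rel" unfolding translation_rel_def by blast
  qed
  show "sym translation_rel"
  proof (rule symI)
    fix S T assume "(S, T) \<in> translation_rel"
    then obtain v where "T = (\<lambda>p. p + v) ` S" by (auto simp: translation_rel_def)
    then have "S = (\<lambda>p. p + (- v)) ` T" by (simp add: image_image)
    then show "(T, S) \<in> translation_rel" unfolding translation_rel_def by blast
  qed
  show "trans translation_rel"
  proof (rule transI)
    fix S T U assume "(S, T) \<in> translation_rel" "(T, U) \<in> translation_rel"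
    then obtain v w where "T = (\<lambda>p. p + v) ` S" "U = (\<lambda>p. p + w) ` T"
      by (auto simp: translation_rel_def)
    then have "U = (\<lambda>p. p + (v + w)) ` S" by (simp add: image_image add.assoc)
    then show "(S, U) \<in> translation_rel" unfolding translation_rel_def by blast
  qed
qed

text \<open>Fixed polyominoes: translation classes of vertex sets.\<close>

definition tree_like_polyominoes :: "nat \<Rightarrow> (int \<times> int) set set set" where
  "tree_like_polyominoes n = {S. tree_like S \<and> card S = n} // translation_rel"

definition saturated_polyominoes :: "nat \<Rightarrow> (int \<times> int) set set set" where
  "saturated_polyominoes n = {S. saturated S \<and> card S = n} // translation_rel"

end

theory Submission
  imports Defs
begin

text \<open>
  The bijection doubles all coordinates of a tree-like set T and then adds the four lattice
  neighbours of every doubled point, its hub; this is \<open>cross_dilation\<close>. An edge of T becomes a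
  straight segment of two edges whose midpoint has degree 2, and every free side of a vertex of T
  becomes a leaf. So a tree with k vertices yields a tree with k + (k - 1) + (2 k + 2) = 4 k + 1
  vertices, of which 2 k + 2 are leaves. The point is that every saturated polyomino of that size
  arises in this way.

  Write ni for the number of vertices of degree i of a tree-like set with n >= 2 vertices. Summing
  degrees gives 2 n1 = n + 2 + n4 - n2, so the bound n1 <= (n + 3) / 2 amounts to n4 <= n2 + 1.
  Next to a vertex of degree 4 (a crossing) no vertex has a sideways neighbour, because an induced
  tree contains no unit square. Hence, when the tree is rooted at a crossing, every other crossing
  has a parent of degree 2 whose only child it is, and this injects all crossings but the root
  into the vertices of degree 2 (\<open>crossings_inject_into_links\<close>).

  Saturation is the case of equality, in which this map is onto for every choice of the root.
  Re-rooting shows that both neighbours of a degree-2 vertex are crossings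
  (\<open>link_between_crossings\<close>), and they lie on opposite sides of it. Walking through the tree, one
  sees only crossings, at mutual displacements of twice a lattice vector, together with their
  neighbours: the set is a cross dilation (\<open>tight_is_cross_dilation\<close>). That the cross dilation of T
  is a tree if and only if T is one follows by counting vertices and edges, using that a
  connected graph is a tree exactly if it has one edge less than vertices
  (\<open>undirected_tree_iff_card_arcs\<close>).
\<close>

section \<open>Trees and their number of arcs\<close>

text \<open>
  The distance from r serves as d, and p picks the last vertex before v on a shortest walk from r.
\<close>

lemma distance_parents:
  assumes reach: "\<And>v. v \<in> V \<Longrightarrow> (r, v) \<in> E\<^sup>*"
  shows "\<exists>p (d :: 'a \<Rightarrow> nat). \<forall>v\<in>V. v \<noteq> r \<longrightarrow> (p v, v) \<in> E \<and> d (p v) < d v"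
proof -
  define d where "d v = (LEAST n. (r, v) \<in> E ^^ n)" for v
  have "\<exists>w. (w, v) \<in> E \<and> d w < d v" if "v \<in> V" "v \<noteq> r" for v
  proof -
    have dv: "(r, v) \<in> E ^^ d v"
      using reach[OF \<open>v \<in> V\<close>] unfolding d_def rtrancl_power by (rule LeastI_ex)
    with \<open>v \<noteq> r\<close> obtain m where m: "d v = Suc m" by (cases "d v") auto
    with dv obtain w where "(r, w) \<in> E ^^ m" and "(w, v) \<in> E" by auto
    moreover from this(1) have "d w \<le> m" unfolding d_def by (rule Least_le)
    ultimately show ?thesis using m by auto
  qed
  then show ?thesis by metis
qed

lemma (in pair_graph) connected_iff_rtrancl:
  "Digraph_Component.connected (with_proj G) \<longleftrightarrow>
    pverts G \<noteq> {} \<and> (\<forall>u\<in>pverts G. \<forall>v\<in>pverts G. (u, v) \<in> (parcs G)\<^sup>*)"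
  using reachable_mk_symmetric_eq[OF sym_arcs]
  by (auto simp: Digraph_Component.connected_def strongly_connected_def reachable_conv)

text \<open>
  A graph with a root in which every other vertex has chosen a neighbour, its parent, of strictly
  smaller depth d. A finite connected graph admits such a choice for every root, with the distance
  from the root as depth; the parent arcs then form a spanning tree.
\<close>

locale rooted_graph = pair_graph G for G :: "'a pair_pre_digraph" +
  fixes r :: 'a and p :: "'a \<Rightarrow> 'a" and d :: "'a \<Rightarrow> nat"
  assumes root: "r \<in> pverts G"
    and parent: "v \<in> pverts G \<Longrightarrow> v \<noteq> r \<Longrightarrow> (v, p v) \<in> parcs G \<and> d (p v) < d v"
begin

definition parent_arcs :: "'a rel" where
  "parent_arcs =
    (\<lambda>v. (v, p v)) ` (pverts G - {r}) \<union> (\<lambda>v. (p v, v)) ` (pverts G - {r})"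

lemma parent_arcs_cases:
  assumes "(u, v) \<in> parent_arcs"
  obtains (up) "u \<in> pverts G" "u \<noteq> r" "v = p u" "d v < d u"
        | (down) "v \<in> pverts G" "v \<noteq> r" "u = p v" "d u < d v"
  using assms parent unfolding parent_arcs_def by auto

lemma parent_arcs_subset: "parent_arcs \<subseteq> parcs G"
  unfolding parent_arcs_def using parent arcs_symmetric by auto

lemma card_parent_arcs: "card parent_arcs + 2 = 2 * card (pverts G)"
proof -
  let ?W = "pverts G - {r}"
  have "\<not> (p v = w \<and> p w = v)" if "v \<in> ?W" "w \<in> ?W" for v w
    using parent[of v] parent[of w] that by auto
  then have "(\<lambda>v. (v, p v)) ` ?W \<inter> (\<lambda>v. (p v, v)) ` ?W = {}"
    by blast
  then have "card parent_arcs = card ((\<lambda>v. (v, p v)) ` ?W) + card ((\<lambda>v. (p v, v)) ` ?W)"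
    unfolding parent_arcs_def by (intro card_Un_disjoint) (auto intro: pair_finite_verts)
  also have "\<dots> = card ?W + card ?W"
    by (simp add: card_image inj_on_def)
  finally show ?thesis
    using root pair_finite_verts card_Suc_Diff1[of "pverts G" r] by simp
qed

lemma root_reachable: "v \<in> pverts G \<Longrightarrow> (v, r) \<in> parent_arcs\<^sup>*"
proof (induction "d v" arbitrary: v rule: less_induct)
  case less
  show ?case
  proof (cases "v = r")
    case False
    with less.prems have "(v, p v) \<in> parent_arcs" by (auto simp: parent_arcs_def)
    moreover have "(p v, r) \<in> parent_arcs\<^sup>*"
      using less parent[OF less.prems False] in_arcsD2 by blast
    ultimately show ?thesis by (rule converse_rtrancl_into_rtrancl)
  qed simp
qed

lemma sym_parent_arcs: "sym parent_arcs"
  by (auto simp: parent_arcs_def sym_def)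

lemma connected: "Digraph_Component.connected (with_proj G)"
proof -
  have "(u, v) \<in> parent_arcs\<^sup>*" if "u \<in> pverts G" "v \<in> pverts G" for u v
    using root_reachable that sym_rtrancl[OF sym_parent_arcs] by (meson rtrancl_trans symE)
  then show ?thesis
    using root rtrancl_mono[OF parent_arcs_subset] by (auto simp: connected_iff_rtrancl)
qed

text \<open>
  An arc (u, w) outside the spanning tree closes a cycle with the tree path from u to w. That path
  has at least two arcs, because (u, w) itself is not available in the tree, so the cycle has
  length at least 3.
\<close>

lemma parent_arcs_eq_if_acyclic:
  assumes acyclic: "\<not> (\<exists>q. cycle q \<and> length q \<ge> 3)"
  shows "parent_arcs = parcs G"
proof (rule ccontr)
  assume "parent_arcs \<noteq> parcs G"
  with parent_arcs_subset obtain u w where uw: "(u, w) \<in> parcs G" "(u, w) \<notin> parent_arcs"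
    by auto
  define H where "H = \<lparr> pverts = pverts G, parcs = parent_arcs \<rparr>"
  interpret H: pair_wf_digraph H
    using parent_arcs_subset in_arcsD1 in_arcsD2
    by unfold_locales (auto simp: H_def)
  have verts: "u \<in> pverts G" "w \<in> pverts G" and "u \<noteq> w"
    using uw wellformed' no_loops' by auto
  have "(u, w) \<in> parent_arcs\<^sup>*"
    using root_reachable verts sym_rtrancl[OF sym_parent_arcs] by (meson rtrancl_trans symE)
  then have "u \<rightarrow>\<^sup>*\<^bsub>with_proj H\<^esub> w"
    using verts unfolding H.reachable_conv by (simp add: H_def)
  then obtain q where q: "H.apath u q w" by (auto simp: H.reachable_apath)
  have "q \<noteq> []" using q \<open>u \<noteq> w\<close> by (auto simp: H.apath_Nil_iff)
  moreover have "q \<noteq> [e]" for e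
  proof
    assume "q = [e]"
    with q have "e \<in> parcs H" "fst e = u" "snd e = w" by (auto simp: H.apath_simps)
    with uw(2) show False by (cases e) (simp add: H_def)
  qed
  ultimately have len: "length q \<ge> 2"
    by (cases q; cases "tl q") auto
  have walk: "awalk u q w"
  proof -
    have "u \<in> pverts H" "set q \<subseteq> parcs H" "pcas u q w"
      using q by (auto simp: H.apath_def H.awalk_def)
    then show ?thesis using parent_arcs_subset by (auto simp: awalk_def H_def)
  qed
  then have "awalk u (q @ [(w, u)]) u"
    using arcs_symmetric[OF uw(1)] verts by (simp add: awalk_simps)
  moreover have "distinct (tl (pawalk_verts u (q @ [(w, u)])))"
  proof -
    have "pawalk_verts u (q @ [(w, u)]) = pawalk_verts u q @ [u]"
      using walk awalk_verts_append[of u q "[(w, u)]" u] \<open>awalk u (q @ [(w, u)]) u\<close> by simp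
    moreover have "distinct (pawalk_verts u q)" using q by (simp add: H.apath_def)
    moreover have "pawalk_verts u q = u # tl (pawalk_verts u q)"
      using walk by (cases q) (auto simp: awalk_simps)
    ultimately show ?thesis
      by (metis append_Cons distinct1_rotate list.sel(3) rotate1.simps(2))
  qed
  ultimately have "cycle (q @ [(w, u)])" by (auto simp: cycle_def)
  with len acyclic show False by fastforce
qed

text \<open>
  In a graph that consists of parent arcs only, a path that avoids the parent of its first vertex
  can only begin by stepping to a child. From there it cannot go back, so it avoids the parent of
  the child, and the argument repeats: the path descends at every step.
\<close>

lemma apath_away_from_parent:
  assumes arcs: "parent_arcs = parcs G"
    and "apath v q w" "q \<noteq> []" "v \<noteq> r" "p v \<notin> set (pawalk_verts v q)"
  shows "d v < d w"
  using assms(2-)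
proof (induction q arbitrary: v)
  case (Cons e q)
  obtain x where e: "e = (v, x)" and x: "(v, x) \<in> parcs G" "apath x q w"
    "v \<notin> set (pawalk_verts x q)"
    using Cons.prems(1) by (cases e) (auto simp: apath_Cons_iff)
  have "x \<in> set (pawalk_verts x q)" using x(2) by (cases q) (auto simp: apath_simps)
  with Cons.prems(4) e have "x \<noteq> p v" by auto
  with x(1) arcs have *: "x \<noteq> r" "p x = v" "d v < d x"
    by (auto elim: parent_arcs_cases)
  show ?case
  proof (cases "q = []")
    case True
    with x(2) * show ?thesis by (simp add: apath_Nil_iff)
  next
    case False
    from Cons.IH[OF x(2) False *(1)] x(3) * show ?thesis by simp
  qed
qed simp

text \<open>
  Cut a cycle at a vertex u, and let x and z be its two neighbours on the cycle. They are distinct,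
  so at least one of them is a child of u, and the rest of the cycle, read from that child,
  descends all the way to the other one. If the other one is the parent of u it lies above u,
  which is absurd; if it is also a child, the same argument from its side gives both
  d x < d z and d z < d x.
\<close>

lemma acyclic_if_parent_arcs_eq:
  assumes arcs: "parent_arcs = parcs G"
  shows "\<not> (\<exists>c. cycle c \<and> length c \<ge> 3)"
proof
  assume "\<exists>c. cycle c \<and> length c \<ge> 3"
  then obtain c u where c: "awalk u c u" "distinct (tl (pawalk_verts u c))" "length c \<ge> 3"
    by (auto simp: cycle_def)
  obtain x q z where q: "c = (u, x) # q @ [(z, u)]"
  proof -
    from c(3) obtain e q' where "c = e # q'" "q' \<noteq> []" by (cases c; cases "tl c") auto
    moreover from this(2) obtain q e' where "q' = q @ [e']" by (metis rev_exhaust)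
    ultimately have "c = e # q @ [e']" by simp
    with c(1) that[of "snd e" q "fst e'"] show ?thesis
      by (cases e; cases e') (auto simp: awalk_simps)
  qed
  have walks: "(u, x) \<in> parcs G" "awalk x q z" "(z, u) \<in> parcs G"
    using c(1) q by (auto simp: awalk_simps)
  have "q \<noteq> []" using c(3) q by auto
  have "awalk x (q @ [(z, u)]) u" using c(1) q by (auto simp: awalk_simps)
  then have "pawalk_verts x (q @ [(z, u)]) = pawalk_verts x q @ [u]"
    using walks(2) awalk_verts_append[of x q "[(z, u)]" u] by simp
  then have dist: "distinct (pawalk_verts x q)" "u \<notin> set (pawalk_verts x q)"
    using c(2) q by auto
  have path: "apath x q z" using walks dist by (simp add: apath_def)
  have rpath: "apath z (rev_path q) x" "u \<notin> set (pawalk_verts z (rev_path q))"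
    using path dist walks awalk_verts_rev_path[OF walks(2)] by auto
  have "x \<noteq> z" using apath_nonempty_ends[OF path] \<open>q \<noteq> []\<close> by simp
  have x: "d x < d z" if "p x = u" "x \<noteq> r"
    using apath_away_from_parent[OF arcs path \<open>q \<noteq> []\<close>] that dist by simp
  have z: "d z < d x" if "p z = u" "z \<noteq> r"
    using apath_away_from_parent[OF arcs rpath(1)] \<open>q \<noteq> []\<close> that rpath(2) by simp
  from walks(1) walks(3) arcs have "(u, x) \<in> parent_arcs" "(z, u) \<in> parent_arcs" by auto
  then show False using x z \<open>x \<noteq> z\<close>
    by (elim parent_arcs_cases) auto
qed

lemma tree_iff_card_arcs:
  "undirected_tree (with_proj G) \<longleftrightarrow> card (parcs G) + 2 = 2 * card (pverts G)"
proof
  assume "undirected_tree (with_proj G)"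
  then show "card (parcs G) + 2 = 2 * card (pverts G)"
    using parent_arcs_eq_if_acyclic card_parent_arcs by (simp add: undirected_tree_def)
next
  assume "card (parcs G) + 2 = 2 * card (pverts G)"
  then have "parent_arcs = parcs G"
    using card_parent_arcs parent_arcs_subset pair_finite_arcs by (intro card_subset_eq) auto
  then show "undirected_tree (with_proj G)"
    using acyclic_if_parent_arcs_eq connected by (simp add: undirected_tree_def)
qed

end

text \<open>
  The spanning tree of parent arcs has exactly 2 (n - 1) arcs, counting both directions of an edge,
  and the graph is acyclic exactly if there are no others. This replaces cycles by counting in all
  that follows.
\<close>

theorem (in pair_graph) undirected_tree_iff_card_arcs:
  "undirected_tree (with_proj G) \<longleftrightarrow>
    Digraph_Component.connected (with_proj G) \<and> card (parcs G) + 2 = 2 * card (pverts G)"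
proof (cases "Digraph_Component.connected (with_proj G)")
  case True
  then obtain r where r: "r \<in> pverts G" and "\<And>v. v \<in> pverts G \<Longrightarrow> (r, v) \<in> (parcs G)\<^sup>*"
    by (auto simp: connected_iff_rtrancl)
  from this(2) obtain p and d :: "'a \<Rightarrow> nat"
    where "\<forall>v\<in>pverts G. v \<noteq> r \<longrightarrow> (p v, v) \<in> parcs G \<and> d (p v) < d v"
    using distance_parents[of "pverts G" r "parcs G"] by blast
  then interpret rooted_graph G r p d
    using r arcs_symmetric by unfold_locales auto
  show ?thesis using tree_iff_card_arcs True by simp
qed (simp add: undirected_tree_def)

section \<open>Induced subgraphs of the square lattice\<close>

definition nbrs :: "int \<times> int \<Rightarrow> (int \<times> int) set" where
  "nbrs v = {v + (1, 0), v + (-1, 0), v + (0, 1), v + (0, -1)}"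

lemma in_nbrs_iff: "w \<in> nbrs v \<longleftrightarrow> w - v \<in> {(1, 0), (-1, 0), (0, 1), (0, -1)}"
  by (auto simp: nbrs_def algebra_simps)

lemma finite_nbrs [simp]: "finite (nbrs v)"
  by (simp add: nbrs_def)

lemma card_nbrs [simp]: "card (nbrs v) = 4"
  by (cases v) (simp add: nbrs_def)

lemma nbrs_irrefl [simp]: "v \<notin> nbrs v"
  by (simp add: in_nbrs_iff zero_prod_def)

lemma nbrs_sym: "w \<in> nbrs v \<longleftrightarrow> v \<in> nbrs w"
  by (cases v; cases w) (auto simp: in_nbrs_iff)

lemma lattice_dist_eq_1_iff: "lattice_dist v w = 1 \<longleftrightarrow> w \<in> nbrs v"
proof -
  obtain a b c d where v: "v = (a, b)" and w: "w = (c, d)" by (cases v; cases w)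
  have "lattice_dist v w = sqrt (of_int ((a - c)\<^sup>2 + (b - d)\<^sup>2))"
    by (simp add: lattice_dist_def dist_prod_def dist_real_def v w)
  then have "lattice_dist v w = 1 \<longleftrightarrow> (a - c)\<^sup>2 + (b - d)\<^sup>2 = 1"
    by (simp only: real_sqrt_eq_1_iff of_int_eq_1_iff)
  also have "\<dots> \<longleftrightarrow> w \<in> nbrs v"
  proof
    assume *: "(a - c)\<^sup>2 + (b - d)\<^sup>2 = 1"
    have sq: "x\<^sup>2 \<le> 1 \<Longrightarrow> x \<in> {-1, 0, 1}" for x :: int
      by (auto simp: abs_square_le_1)
    from * have "a - c \<in> {-1, 0, 1}" "b - d \<in> {-1, 0, 1}"
      by (auto intro!: sq simp del: insert_iff)
         (smt (verit) zero_le_power2)+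
    with * show "w \<in> nbrs v" by (auto simp: in_nbrs_iff v w)
  next
    assume "w \<in> nbrs v"
    then have "(c = a + 1 \<or> c = a - 1) \<and> d = b \<or> c = a \<and> (d = b + 1 \<or> d = b - 1)"
      by (auto simp: in_nbrs_iff v w)
    then show "(a - c)\<^sup>2 + (b - d)\<^sup>2 = 1" by auto
  qed
  finally show ?thesis .
qed

definition lattice_arcs :: "(int \<times> int) set \<Rightarrow> (int \<times> int) rel" where
  "lattice_arcs S = {(v, w). v \<in> S \<and> w \<in> S \<and> w \<in> nbrs v}"

definition lattice_degree :: "(int \<times> int) set \<Rightarrow> int \<times> int \<Rightarrow> nat" where
  "lattice_degree S v = card (S \<inter> nbrs v)"

lemma lattice_subgraph_eq:
  "lattice_subgraph S = with_proj \<lparr> pverts = S, parcs = lattice_arcs S \<rparr>"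
  by (auto simp: lattice_subgraph_def induce_subgraph_def square_lattice_def with_proj_def
      lattice_arcs_def lattice_dist_eq_1_iff)

lemma finite_lattice_arcs: "finite S \<Longrightarrow> finite (lattice_arcs S)"
  by (rule finite_subset[of _ "S \<times> S"]) (auto simp: lattice_arcs_def)

lemma sym_lattice_arcs: "sym (lattice_arcs S)"
  by (auto simp: sym_def lattice_arcs_def nbrs_sym)

lemma pair_graph_lattice:
  assumes "finite S"
  shows "pair_graph \<lparr> pverts = S, parcs = lattice_arcs S \<rparr>"
  using assms finite_lattice_arcs[OF assms] sym_lattice_arcs[of S]
  by unfold_locales (auto simp: symmetric_def lattice_arcs_def)

lemma out_degree_lattice_subgraph:
  assumes "v \<in> S"
  shows "out_degree (lattice_subgraph S) v = lattice_degree S v"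
proof -
  have "out_arcs (lattice_subgraph S) v = Pair v ` (S \<inter> nbrs v)"
    using assms by (auto simp: out_arcs_def lattice_subgraph_eq lattice_arcs_def)
  then show ?thesis
    by (simp add: out_degree_def lattice_degree_def card_image inj_on_def)
qed

lemma num_leaves_eq: "num_leaves S = card {v \<in> S. lattice_degree S v = 1}"
  unfolding num_leaves_def by (intro arg_cong[of _ _ card]) (auto simp: out_degree_lattice_subgraph)

lemma sum_lattice_degree:
  assumes "finite S"
  shows "(\<Sum>v\<in>S. lattice_degree S v) = card (lattice_arcs S)"
proof -
  have "lattice_arcs S = (SIGMA v:S. S \<inter> nbrs v)" by (auto simp: lattice_arcs_def)
  then show ?thesis using assms by (simp add: lattice_degree_def card_SigmaI)
qed

definition lattice_connected :: "(int \<times> int) set \<Rightarrow> bool" where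
  "lattice_connected S \<longleftrightarrow> S \<noteq> {} \<and> (\<forall>u\<in>S. \<forall>v\<in>S. (u, v) \<in> (lattice_arcs S)\<^sup>*)"

lemma tree_like_iff:
  "tree_like S \<longleftrightarrow>
    finite S \<and> lattice_connected S \<and> card (lattice_arcs S) + 2 = 2 * card S"
proof (cases "finite S")
  case True
  then interpret pair_graph "\<lparr> pverts = S, parcs = lattice_arcs S \<rparr>"
    by (rule pair_graph_lattice)
  show ?thesis
    using undirected_tree_iff_card_arcs connected_iff_rtrancl
    by (simp add: tree_like_def lattice_subgraph_eq lattice_connected_def)
qed (simp add: tree_like_def)

text \<open>
  The subgraph induced by the corners of a unit square is a 4-cycle. This is what limits the number
  of vertices of degree 4.
\<close>

lemma tree_like_no_square:
  assumes "tree_like S" "{a, b, c, d} \<subseteq> S" "a \<noteq> c" "b \<noteq> d"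
    "b \<in> nbrs a" "c \<in> nbrs b" "d \<in> nbrs c" "a \<in> nbrs d"
  shows False
proof -
  define G where "G = \<lparr> pverts = S, parcs = lattice_arcs S \<rparr>"
  interpret pair_graph G
    using assms(1) unfolding G_def by (intro pair_graph_lattice) (simp add: tree_like_def)
  have "{a, b, c, d} \<subseteq> pverts G" "{(a, b), (b, c), (c, d), (d, a)} \<subseteq> parcs G"
    using assms by (auto simp: G_def lattice_arcs_def)
  then have "awalk a [(a, b), (b, c), (c, d), (d, a)] a"
    by (simp add: awalk_simps)
  moreover have "distinct (tl (pawalk_verts a [(a, b), (b, c), (c, d), (d, a)]))"
    using assms by auto
  ultimately have "cycle [(a, b), (b, c), (c, d), (d, a)]"
    unfolding cycle_def by blast
  moreover have "\<not> (\<exists>p. cycle p \<and> length p \<ge> 3)"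
    using assms(1) by (simp add: tree_like_def undirected_tree_def lattice_subgraph_eq G_def)
  ultimately show False by fastforce
qed

section \<open>Degrees in tree-like sets and the bound on the number of leaves\<close>

text \<open>
  The vertices of degree 4, stated without reference to degrees so that translations act on
  them visibly.
\<close>

definition crossings :: "(int \<times> int) set \<Rightarrow> (int \<times> int) set" where
  "crossings S = {v \<in> S. nbrs v \<subseteq> S}"

text \<open>
  In the extremal case these are the vertices that link two crossings.
\<close>

definition links :: "(int \<times> int) set \<Rightarrow> (int \<times> int) set" where
  "links S = {v \<in> S. lattice_degree S v = 2}"

lemma lattice_degree_le_4: "lattice_degree S v \<le> 4"
  unfolding lattice_degree_def by (metis card_mono card_nbrs finite_nbrs inf_le2)

lemma lattice_degree_eq_4_iff: "lattice_degree S v = 4 \<longleftrightarrow> nbrs v \<subseteq> S"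
proof
  assume "lattice_degree S v = 4"
  then have "S \<inter> nbrs v = nbrs v"
    by (intro card_subset_eq) (auto simp: lattice_degree_def)
  then show "nbrs v \<subseteq> S" by blast
next
  assume "nbrs v \<subseteq> S"
  then have "S \<inter> nbrs v = nbrs v" by blast
  then show "lattice_degree S v = 4" by (simp add: lattice_degree_def)
qed

text \<open>
  Otherwise v, u, w and the point opposite to u would be the corners of a unit square.
\<close>

lemma crossing_neighbour_straight:
  assumes "tree_like S" "v \<in> crossings S" "u \<in> nbrs v"
  shows "S \<inter> nbrs u \<subseteq> {v, u + u - v}"
proof
  fix w assume w: "w \<in> S \<inter> nbrs u"
  show "w \<in> {v, u + u - v}"
  proof (rule ccontr)
    assume "w \<notin> {v, u + u - v}"
    \<comment> \<open>v + w - u is the fourth corner of the square with consecutive corners v, u, w; it is also a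
      neighbour of v, hence in S.\<close>
    then have "v + w - u \<noteq> u" "w \<noteq> v" by (auto simp: algebra_simps)
    moreover have "v + w - u \<in> nbrs v" "w \<in> nbrs u"
      using w by (auto simp: in_nbrs_iff)
    moreover have "v + w - u \<in> nbrs w"
      using assms(3) by (cases v; cases u; cases w) (auto simp: in_nbrs_iff)
    moreover have "{v, u, w, v + w - u} \<subseteq> S"
      using assms(2,3) w calculation by (auto simp: crossings_def)
    ultimately show False
      using tree_like_no_square[OF assms(1), of v u w "v + w - u"] assms(3) nbrs_sym by auto
  qed
qed

lemma not_crossing_if_neighbour:
  assumes "tree_like S" "v \<in> crossings S" "u \<in> nbrs v"
  shows "lattice_degree S u \<le> 2" "u \<notin> crossings S"
proof -
  have "card (S \<inter> nbrs u) \<le> card {v, u + u - v}"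
    using crossing_neighbour_straight[OF assms] by (intro card_mono) auto
  also have "\<dots> \<le> 2" by (simp add: card_insert_if)
  finally show "lattice_degree S u \<le> 2" by (simp add: lattice_degree_def)
  then show "u \<notin> crossings S" using lattice_degree_eq_4_iff[of S u] by (auto simp: crossings_def)
qed

lemma crossings_eq: "crossings S = {v \<in> S. lattice_degree S v = 4}"
  by (auto simp: crossings_def lattice_degree_eq_4_iff)

text \<open>
  Root the tree at the crossing r and send every other crossing to its parent m. Next to a crossing
  the degree is at most 2, so m is not r and has a parent of its own; hence m has degree exactly 2
  and only one child, which makes the map injective.
\<close>

lemma crossings_inject_into_links:
  assumes S: "tree_like S" and r: "r \<in> crossings S"
  shows "\<exists>p. inj_on p (crossings S - {r}) \<and>
    (\<forall>u\<in>crossings S - {r}. p u \<in> links S \<and> u \<in> nbrs (p u))"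
proof -
  have "r \<in> S" using r by (simp add: crossings_def)
  with S have "(r, v) \<in> (lattice_arcs S)\<^sup>*" if "v \<in> S" for v
    using that by (simp add: tree_like_iff lattice_connected_def)
  then obtain p and d :: "int \<times> int \<Rightarrow> nat"
    where pd: "\<forall>v\<in>S. v \<noteq> r \<longrightarrow> (p v, v) \<in> lattice_arcs S \<and> d (p v) < d v"
    using distance_parents[of S r "lattice_arcs S"] by blast
  have key: "p u \<in> S" "S \<inter> nbrs (p u) = {u, p (p u)}" "d (p (p u)) < d u"
    if "u \<in> crossings S - {r}" for u
  proof -
    have "u \<in> S" "u \<noteq> r" using that by (auto simp: crossings_def)
    with pd have m: "p u \<in> S" "u \<in> nbrs (p u)" "d (p u) < d u"
      by (auto simp: lattice_arcs_def)
    have deg: "lattice_degree S (p u) \<le> 2" "p u \<noteq> r"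
      using not_crossing_if_neighbour[OF S, of u "p u"] that m r nbrs_sym by auto
    with pd m have pp: "p (p u) \<in> S" "p (p u) \<in> nbrs (p u)" "d (p (p u)) < d (p u)"
      using nbrs_sym by (auto simp: lattice_arcs_def)
    have "u \<noteq> p (p u)" using m pp by auto
    then have "{u, p (p u)} = S \<inter> nbrs (p u)"
      using deg(1) m pp \<open>u \<in> S\<close> by (intro card_seteq) (auto simp: lattice_degree_def)
    then show "p u \<in> S" "S \<inter> nbrs (p u) = {u, p (p u)}" "d (p (p u)) < d u"
      using m pp by auto
  qed
  have "inj_on p (crossings S - {r})"
  proof (rule inj_onI)
    fix u u' assume u: "u \<in> crossings S - {r}" "u' \<in> crossings S - {r}" "p u = p u'"
    then have "u' \<in> {u, p (p u)}" using key(2)[OF u(1)] key(2)[OF u(2)] by auto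
    moreover have "u' \<noteq> p (p u)" using key(3)[OF u(2)] u(3) by auto
    ultimately show "u = u'" by simp
  qed
  moreover have "p u \<in> links S" "u \<in> nbrs (p u)" if "u \<in> crossings S - {r}" for u
  proof -
    have "u \<noteq> p (p u)" using key(3)[OF that] by auto
    then show "p u \<in> links S" using key(1,2)[OF that] by (simp add: links_def lattice_degree_def)
    show "u \<in> nbrs (p u)" using key(2)[OF that] by blast
  qed
  ultimately show ?thesis by blast
qed

lemma card_crossings_le:
  assumes "tree_like S"
  shows "card (crossings S) \<le> card (links S) + 1"
proof (cases "crossings S = {}")
  case False
  then obtain r where r: "r \<in> crossings S" by blast
  obtain p where "inj_on p (crossings S - {r})" "p ` (crossings S - {r}) \<subseteq> links S"
    using crossings_inject_into_links[OF assms r] by blast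
  moreover have "finite (links S)" using assms by (simp add: tree_like_def links_def)
  ultimately have "card (crossings S - {r}) \<le> card (links S)" by (rule card_inj_on_le)
  with r show ?thesis by (simp add: card_Diff_singleton_if split: if_splits)
qed simp

text \<open>
  In the extremal case the parent map from crossings to degree-2 vertices is onto for every choice
  of the root. So next to a degree-2 vertex b there is a crossing u; rooting at u produces another
  one, and then both neighbours of b are crossings.
\<close>

lemma link_between_crossings:
  assumes S: "tree_like S" and tight: "card (crossings S) = card (links S) + 1"
    and b: "b \<in> links S"
  shows "S \<inter> nbrs b \<subseteq> crossings S"
proof -
  have fin: "finite (links S)" "finite S" using S by (auto simp: tree_like_def links_def)
  have other: "\<exists>u\<in>crossings S. u \<noteq> r \<and> u \<in> nbrs b" if r: "r \<in> crossings S" for r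
  proof -
    obtain p where p: "inj_on p (crossings S - {r})"
      "\<forall>u\<in>crossings S - {r}. p u \<in> links S \<and> u \<in> nbrs (p u)"
      using crossings_inject_into_links[OF S r] by blast
    have "card (crossings S - {r}) = card (links S)" using r tight by simp
    then have "card (p ` (crossings S - {r})) = card (links S)" by (simp add: card_image[OF p(1)])
    moreover have "p ` (crossings S - {r}) \<subseteq> links S" using p(2) by blast
    ultimately have "p ` (crossings S - {r}) = links S" using fin by (intro card_subset_eq)
    with b have "b \<in> p ` (crossings S - {r})" by simp
    then obtain u where "u \<in> crossings S - {r}" "p u = b" by (metis imageE)
    with p(2) show ?thesis by auto
  qed
  have "crossings S \<noteq> {}" using tight by (metis Suc_eq_plus1 card.empty nat.distinct(1))
  then obtain u where u: "u \<in> crossings S" "u \<in> nbrs b" using other by blast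
  obtain w where w: "w \<in> crossings S" "w \<noteq> u" "w \<in> nbrs b" using other[OF u(1)] by blast
  have "{u, w} = S \<inter> nbrs b"
    using u w b by (intro card_seteq) (auto simp: links_def lattice_degree_def crossings_def)
  then have "S \<inter> nbrs b = {u, w}" ..
  with u w show ?thesis by simp
qed

lemma degree_pos:
  assumes "tree_like S" "card S \<ge> 2" "v \<in> S"
  shows "lattice_degree S v \<ge> 1"
proof -
  have fin: "finite S" using assms(1) by (simp add: tree_like_def)
  obtain w where "w \<in> S" "w \<noteq> v"
    using assms(2,3) by (metis card_le_Suc0_iff_eq fin not_less_eq_eq numeral_2_eq_2)
  then have "(v, w) \<in> (lattice_arcs S)\<^sup>*" "v \<noteq> w"
    using assms by (auto simp: tree_like_iff lattice_connected_def)
  then obtain x where "(v, x) \<in> lattice_arcs S" by (meson converse_rtranclE)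
  then have "S \<inter> nbrs v \<noteq> {}" by (auto simp: lattice_arcs_def)
  then show ?thesis using fin by (simp add: lattice_degree_def Suc_le_eq card_gt_0_iff)
qed


text \<open>
  Both identities come from summing over the vertices of a tree, whose degrees lie between 1 and 4:
  the degrees add up to 2 (n - 1), and the four degree classes partition the vertices.
\<close>

lemma
  assumes S: "tree_like S" and card: "card S \<ge> 2"
  shows leaf_count:
      "num_leaves S = card {v \<in> S. lattice_degree S v = 3} + 2 * card (crossings S) + 2"
    and degree_partition:
      "num_leaves S + card (links S) + card {v \<in> S. lattice_degree S v = 3}
        + card (crossings S) = card S"
proof -
  have fin: "finite S" using S by (simp add: tree_like_def)
  define n where "n i = (\<Sum>v\<in>S. of_bool (lattice_degree S v = i) :: nat)" for i :: nat
  have n: "card {v \<in> S. lattice_degree S v = i} = n i" for i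
    using fin by (simp add: n_def of_bool_def sum.If_cases Int_def)
  have deg: "lattice_degree S v \<in> {1, 2, 3, 4}" if "v \<in> S" for v
    using degree_pos[OF S card that] lattice_degree_le_4[of S v] by auto
  have "(\<Sum>v\<in>S. lattice_degree S v)
      = (\<Sum>v\<in>S. of_bool (lattice_degree S v = 1) + 2 * of_bool (lattice_degree S v = 2)
        + 3 * of_bool (lattice_degree S v = 3) + 4 * of_bool (lattice_degree S v = 4))"
    by (intro sum.cong refl) (use deg in fastforce)
  also have "\<dots> = n 1 + 2 * n 2 + 3 * n 3 + 4 * n 4"
    by (simp add: n_def sum.distrib sum_distrib_left)
  finally have degs: "n 1 + 2 * n 2 + 3 * n 3 + 4 * n 4 + 2 = 2 * card S"
    using S fin by (simp add: sum_lattice_degree tree_like_iff)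
  have "card S = (\<Sum>v\<in>S. 1)" by simp
  also have "\<dots> = (\<Sum>v\<in>S. of_bool (lattice_degree S v = 1) + of_bool (lattice_degree S v = 2)
        + of_bool (lattice_degree S v = 3) + of_bool (lattice_degree S v = 4))"
    by (intro sum.cong refl) (use deg in fastforce)
  also have "\<dots> = n 1 + n 2 + n 3 + n 4"
    by (simp add: n_def sum.distrib)
  finally have part: "card S = n 1 + n 2 + n 3 + n 4" .
  show "num_leaves S = card {v \<in> S. lattice_degree S v = 3} + 2 * card (crossings S) + 2"
    "num_leaves S + card (links S) + card {v \<in> S. lattice_degree S v = 3}
        + card (crossings S) = card S"
    unfolding num_leaves_eq links_def crossings_eq n using degs part by simp_all
qed

text \<open>
  The two identities of the degree count combine to 2 n1 = n + 2 + n4 - n2, where ni is the number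
  of vertices of degree i. So the inequality n4 <= n2 + 1 is the bound n1 <= (n + 3) / 2, and a set
  that reaches it is automatically fully leafed.
\<close>

lemma saturated_iff_tight:
  assumes card: "card S \<ge> 2"
  shows "saturated S \<longleftrightarrow> tree_like S \<and> card (crossings S) = card (links S) + 1"
proof -
  have excess: "2 * num_leaves T + card (links T) = card T + 2 + card (crossings T)"
    if "tree_like T" "card T = card S" for T
    using leaf_count[of T] degree_partition[of T] that card by linarith
  have bound: "2 * num_leaves T \<le> card S + 3" if "tree_like T" "card T = card S" for T
    using excess[OF that] card_crossings_le[of T] that by linarith
  have max: "L_squ (card S) = num_leaves S"
    if "tree_like S" "2 * num_leaves S = card S + 3"
    unfolding L_squ_def
  proof (rule Max_eqI)
    have le: "num_leaves T \<le> num_leaves S" if "tree_like T" "card T = card S" for T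
      using bound[OF that] \<open>2 * num_leaves S = card S + 3\<close> by linarith
    then have "{num_leaves T |T. tree_like T \<and> card T = card S} \<subseteq> {..num_leaves S}" by blast
    then show "finite {num_leaves T |T. tree_like T \<and> card T = card S}"
      by (rule finite_subset) simp
    show "y \<le> num_leaves S" if "y \<in> {num_leaves T |T. tree_like T \<and> card T = card S}" for y
      using that le by blast
    show "num_leaves S \<in> {num_leaves T |T. tree_like T \<and> card T = card S}"
      using that by blast
  qed
  have real_iff: "real (num_leaves S) \<ge> L_squ_bar (card S) \<longleftrightarrow> card S + 3 \<le> 2 * num_leaves S"
    by (simp add: L_squ_bar_def) linarith
  have "saturated S \<longleftrightarrow> tree_like S \<and> 2 * num_leaves S = card S + 3"
  proof
    assume "saturated S"
    then have "tree_like S" "card S + 3 \<le> 2 * num_leaves S"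
      unfolding saturated_def fully_leafed_def real_iff by blast+
    with bound[of S] show "tree_like S \<and> 2 * num_leaves S = card S + 3" by simp
  next
    assume "tree_like S \<and> 2 * num_leaves S = card S + 3"
    with max show "saturated S"
      unfolding saturated_def fully_leafed_def real_iff by simp
  qed
  moreover have "2 * num_leaves S = card S + 3 \<longleftrightarrow> card (crossings S) = card (links S) + 1"
    if "tree_like S"
    using excess[OF that refl] by presburger
  ultimately show ?thesis by blast
qed

section \<open>The cross dilation\<close>

text \<open>
  The point r + 2 t. The origin r is a parameter because the crossings of a saturated polyomino
  lie on an arbitrary translate of the sublattice of even points.
\<close>

definition hub :: "int \<times> int \<Rightarrow> int \<times> int \<Rightarrow> int \<times> int" where
  "hub r t = r + t + t"

definition cross_dilation :: "int \<times> int \<Rightarrow> (int \<times> int) set \<Rightarrow> (int \<times> int) set" where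
  "cross_dilation r T = hub r ` T \<union> (\<Union>t\<in>T. nbrs (hub r t))"

lemma hub_eq_iff [simp]: "hub r s = hub r t \<longleftrightarrow> s = t"
  by (cases r; cases s; cases t) (auto simp: hub_def)

text \<open>
  A point next to two different hubs is the midpoint between them.
\<close>

lemma nbrs_hub_cases:
  assumes "u \<in> nbrs (hub r s)" "u \<in> nbrs (hub r t)"
  shows "s = t \<or> s \<in> nbrs t"
proof -
  define d where "d = u - hub r s"
  define e where "e = u - hub r t"
  define x where "x = s - t"
  have "d \<in> {(1, 0), (-1, 0), (0, 1), (0, -1)}" "e \<in> {(1, 0), (-1, 0), (0, 1), (0, -1)}"
    using assms by (simp_all add: d_def e_def in_nbrs_iff)
  moreover have "x + x = e - d" by (simp add: x_def d_def e_def hub_def algebra_simps)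
  then have "2 * fst x = fst e - fst d" "2 * snd x = snd e - snd d"
    by (simp_all add: prod_eq_iff)
  ultimately have "x \<in> {(0, 0), (1, 0), (-1, 0), (0, 1), (0, -1)}"
    unfolding insert_iff empty_iff prod_eq_iff fst_conv snd_conv by presburger
  then show ?thesis by (auto simp: x_def in_nbrs_iff zero_prod_def[symmetric])
qed

text \<open>
  Colour the lattice like a chessboard. All hubs have the colour of r and their neighbours
  the opposite one, which rules out all adjacencies except those between a hub and its own
  neighbours.
\<close>

lemma even_nbrs:
  "w \<in> nbrs v \<Longrightarrow> even (fst w + snd w) \<longleftrightarrow> odd (fst v + snd v)"
  by (auto simp: nbrs_def)

lemma even_hub: "even (fst (hub r t) + snd (hub r t)) \<longleftrightarrow> even (fst r + snd r)"
  by (simp add: hub_def)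

lemma hub_not_nbr_hub: "hub r s \<notin> nbrs (hub r t)"
  using even_nbrs even_hub by blast

lemma nbrs_hubs_not_adjacent:
  assumes "u \<in> nbrs (hub r s)" "v \<in> nbrs (hub r t)"
  shows "v \<notin> nbrs u"
  using assms even_nbrs even_hub by blast

lemma
  assumes "t \<in> T"
  shows hub_in_cross_dilation: "hub r t \<in> cross_dilation r T"
    and nbr_in_cross_dilation: "w \<in> nbrs (hub r t) \<Longrightarrow> w \<in> cross_dilation r T"
  using assms by (auto simp: cross_dilation_def simp del: split_paired_Ex split_paired_All)

lemma cross_dilation_cases:
  assumes "v \<in> cross_dilation r T"
  obtains (hub) t where "t \<in> T" "v = hub r t"
        | (nbr) t where "t \<in> T" "v \<in> nbrs (hub r t)"
  using assms unfolding cross_dilation_def by blast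

section \<open>The shape of extremal sets\<close>

text \<open>
  Walk from r. Each crossing is surrounded by four vertices; from such a vertex the walk can only
  return or go straight on, and in the latter case the vertex has degree 2, so that the walk
  arrives at a crossing, displaced by twice a unit step.
\<close>

lemma tight_is_cross_dilation:
  assumes S: "tree_like S" and tight: "card (crossings S) = card (links S) + 1"
    and r: "r \<in> crossings S"
  shows "S = cross_dilation r {t. hub r t \<in> crossings S}" (is "S = ?X")
proof
  show "?X \<subseteq> S"
    unfolding cross_dilation_def crossings_def by blast
  show "S \<subseteq> ?X"
  proof
    fix v assume "v \<in> S"
    with r S have "(r, v) \<in> (lattice_arcs S)\<^sup>*"
      by (simp add: tree_like_iff lattice_connected_def crossings_def)
    then show "v \<in> ?X"
    proof induction
      case base
      have "hub r 0 = r" by (simp add: hub_def)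
      with r show ?case using hub_in_cross_dilation[of 0 _ r] by simp
    next
      case (step v w)
      from step(2) have vw: "v \<in> S" "w \<in> S" "w \<in> nbrs v" by (simp_all add: lattice_arcs_def)
      from step(3) show ?case
      proof (cases rule: cross_dilation_cases)
        case (hub t)
        with vw show ?thesis by (intro nbr_in_cross_dilation[of t]) simp_all
      next
        case (nbr t)
        then have cr: "hub r t \<in> crossings S" "v \<in> nbrs (hub r t)" by simp_all
        show ?thesis
        proof (cases "w = hub r t")
          case True
          with nbr show ?thesis using hub_in_cross_dilation by simp
        next
          case False
          with crossing_neighbour_straight[OF S cr] vw
          have w: "w = v + v - hub r t" by blast
          have "hub r t \<in> nbrs v" using cr nbrs_sym by simp
          then have "{hub r t, w} \<subseteq> S \<inter> nbrs v" using cr vw by (simp add: crossings_def)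
          then have "card {hub r t, w} \<le> lattice_degree S v"
            unfolding lattice_degree_def by (intro card_mono) simp_all
          then have "v \<in> links S"
            using not_crossing_if_neighbour(1)[OF S cr] vw False by (simp add: links_def)
          then have "w \<in> crossings S" using link_between_crossings[OF S tight] vw by blast
          \<comment> \<open>v - hub r t is the unit step taken from the crossing, so w is the hub of the
            next lattice point.\<close>
          moreover have "hub r (t + v - hub r t) = w"
            by (simp add: w hub_def algebra_simps)
          ultimately show ?thesis
            using hub_in_cross_dilation[of "t + v - hub r t" "{t. hub r t \<in> crossings S}" r]
            by simp
        qed
      qed
    qed
  qed
qed

section \<open>Saturated sets as cross dilations of trees\<close>

text \<open>
  The edges of T in direction s, each represented by its starting point.
\<close>

definition steps_in :: "(int \<times> int) set \<Rightarrow> int \<times> int \<Rightarrow> (int \<times> int) set" where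
  "steps_in T s = {t \<in> T. t + s \<in> T}"

lemma card_steps_in_minus: "card (steps_in T (- s)) = card (steps_in T s)"
proof -
  have "x \<in> (\<lambda>t. t + s) ` steps_in T s" if "x \<in> steps_in T (- s)" for x
    using that by (intro image_eqI[of _ _ "x - s"]) (simp_all add: steps_in_def)
  moreover have "t + s \<in> steps_in T (- s)" if "t \<in> steps_in T s" for t
    using that by (simp add: steps_in_def)
  ultimately have "steps_in T (- s) = (\<lambda>t. t + s) ` steps_in T s" by blast
  then show ?thesis by (simp add: card_image)
qed

lemma card_lattice_arcs:
  assumes "finite T"
  shows "card (lattice_arcs T) = 2 * (card (steps_in T (1, 0)) + card (steps_in T (0, 1)))"
proof -
  define D where "D = {(1, 0), (-1, 0), (0, 1), (0, -1) :: int \<times> int}"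
  have fin: "finite (steps_in T s)" for s using assms by (simp add: steps_in_def)
  have arcs: "(v, w) \<in> lattice_arcs T \<longleftrightarrow> v \<in> T \<and> w \<in> T \<and> w - v \<in> D" for v w
    by (simp add: lattice_arcs_def in_nbrs_iff D_def)
  have "bij_betw (\<lambda>(v, w). (w - v, v)) (lattice_arcs T) (SIGMA s:D. steps_in T s)"
    by (rule bij_betw_byWitness[where f' = "\<lambda>(s, t). (t, t + s)"])
      (auto simp: arcs steps_in_def)
  then have "card (lattice_arcs T) = card (SIGMA s:D. steps_in T s)"
    by (rule bij_betw_same_card)
  also have "\<dots> = (\<Sum>s\<in>D. card (steps_in T s))"
    using fin by (simp add: D_def)
  finally show ?thesis
    using card_steps_in_minus[of T "(1, 0)"] card_steps_in_minus[of T "(0, 1)"]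
    by (simp add: D_def)
qed

text \<open>
  For a unit step s this includes the leaves of the dilation in directions s and - s, which lie
  halfway to the hub of a point outside T.
\<close>

definition midpoints :: "int \<times> int \<Rightarrow> (int \<times> int) set \<Rightarrow> int \<times> int \<Rightarrow> (int \<times> int) set" where
  "midpoints r T s = (\<lambda>t. hub r t + s) ` T \<union> (\<lambda>t. hub r t - s) ` T"

text \<open>
  The two translates of the set of hubs overlap exactly in the midpoints of the edges in
  direction s.
\<close>

lemma card_midpoints:
  assumes "finite T"
  shows "card (midpoints r T s) + card (steps_in T s) = 2 * card T"
proof -
  have eq: "hub r t + s = hub r u - s \<longleftrightarrow> u = t + s" for t u
  proof -
    have "hub r t + s = hub r u - s \<longleftrightarrow> hub r (t + s) = hub r u"
      by (auto simp: hub_def algebra_simps)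
    then show ?thesis by auto
  qed
  have "(\<lambda>t. hub r t + s) ` T \<inter> (\<lambda>t. hub r t - s) ` T = (\<lambda>t. hub r t + s) ` steps_in T s"
  proof (intro equalityI subsetI)
    fix x assume "x \<in> (\<lambda>t. hub r t + s) ` T \<inter> (\<lambda>t. hub r t - s) ` T"
    then obtain t u where "t \<in> T" "u \<in> T" "x = hub r t + s" "x = hub r u - s" by blast
    with eq[of t u] show "x \<in> (\<lambda>t. hub r t + s) ` steps_in T s" by (simp add: steps_in_def)
  next
    fix x assume "x \<in> (\<lambda>t. hub r t + s) ` steps_in T s"
    then obtain t where "t \<in> T" "t + s \<in> T" "x = hub r t + s" by (auto simp: steps_in_def)
    with eq[of t "t + s"] show "x \<in> (\<lambda>t. hub r t + s) ` T \<inter> (\<lambda>t. hub r t - s) ` T" by blast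
  qed
  then have "card ((\<lambda>t. hub r t + s) ` T \<inter> (\<lambda>t. hub r t - s) ` T) = card (steps_in T s)"
    by (simp add: card_image inj_on_def)
  moreover have "card ((\<lambda>t. hub r t + s) ` T) = card T" "card ((\<lambda>t. hub r t - s) ` T) = card T"
    by (simp_all add: card_image inj_on_def)
  ultimately show ?thesis
    using card_Un_Int[of "(\<lambda>t. hub r t + s) ` T" "(\<lambda>t. hub r t - s) ` T"] assms
    by (simp add: midpoints_def)
qed

text \<open>
  There is one hub for each vertex of T and, in each of the two directions, two points for each
  vertex less one for each edge.
\<close>

lemma card_cross_dilation:
  assumes "finite T"
  shows "2 * card (cross_dilation r T) + card (lattice_arcs T) = 10 * card T"
proof -
  have minus: "x - (1, 0) = x + (-1, 0)" "x - (0, 1) = x + (0, -1)" for x :: "int \<times> int"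
    by (simp_all add: prod_eq_iff)
  have eq: "cross_dilation r T = hub r ` T \<union> (midpoints r T (1, 0) \<union> midpoints r T (0, 1))"
    unfolding cross_dilation_def midpoints_def nbrs_def minus by blast
  have fin: "finite (midpoints r T s)" for s using assms by (simp add: midpoints_def)
  have "midpoints r T (1, 0) \<union> midpoints r T (0, 1) \<subseteq> (\<Union>t\<in>T. nbrs (hub r t))"
    unfolding midpoints_def nbrs_def minus by blast
  then have "hub r ` T \<inter> (midpoints r T (1, 0) \<union> midpoints r T (0, 1)) = {}"
    using hub_not_nbr_hub[of r] by blast
  moreover have "odd (fst x - fst r)" if "x \<in> midpoints r T (1, 0)" for x
    using that by (auto simp: midpoints_def hub_def)
  moreover have "even (fst x - fst r)" if "x \<in> midpoints r T (0, 1)" for x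
    using that by (auto simp: midpoints_def hub_def)
  moreover from calculation have "midpoints r T (1, 0) \<inter> midpoints r T (0, 1) = {}"
    by blast
  ultimately have "card (cross_dilation r T)
      = card (hub r ` T) + (card (midpoints r T (1, 0)) + card (midpoints r T (0, 1)))"
    using assms fin by (simp add: eq card_Un_disjoint)
  moreover have "card (hub r ` T) = card T" by (simp add: card_image inj_on_def)
  moreover note card_midpoints[OF assms, of r "(1, 0)"] card_midpoints[OF assms, of r "(0, 1)"]
    card_lattice_arcs[OF assms]
  ultimately show ?thesis by simp
qed

lemma lattice_arcs_cross_dilation:
  "lattice_arcs (cross_dilation r T) = (SIGMA h:hub r ` T. nbrs h) \<union> (SIGMA h:hub r ` T. nbrs h)\<inverse>"
    (is "_ = ?P \<union> ?P\<inverse>")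
proof
  show "?P \<union> ?P\<inverse> \<subseteq> lattice_arcs (cross_dilation r T)"
    by (auto simp: lattice_arcs_def cross_dilation_def nbrs_sym)
  show "lattice_arcs (cross_dilation r T) \<subseteq> ?P \<union> ?P\<inverse>"
  proof
    fix e assume "e \<in> lattice_arcs (cross_dilation r T)"
    then show "e \<in> ?P \<union> ?P\<inverse>"
      using nbrs_hubs_not_adjacent[of _ r] nbrs_sym
      unfolding lattice_arcs_def cross_dilation_def by blast
  qed
qed

text \<open>
  By the chessboard argument every edge joins a hub to one of its four neighbours.
\<close>

lemma card_lattice_arcs_cross_dilation:
  assumes "finite T"
  shows "card (lattice_arcs (cross_dilation r T)) = 8 * card T"
proof -
  let ?P = "SIGMA h:hub r ` T. nbrs h"
  have "?P \<inter> ?P\<inverse> = {}" using hub_not_nbr_hub[of r] by blast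
  moreover have "finite ?P" using assms by simp
  moreover have "card ?P = 4 * card T" using assms by (simp add: card_image inj_on_def)
  ultimately show ?thesis
    by (simp add: lattice_arcs_cross_dilation card_Un_disjoint card_inverse)
qed

text \<open>
  An edge of T becomes two edges through its midpoint, and every non-hub hangs on a hub. Conversely,
  follow a walk in the dilation and record the vertices of T whose hub is the present point or
  adjacent to it: two such vertices are equal or adjacent.
\<close>

lemma lattice_connected_cross_dilation:
  "lattice_connected (cross_dilation r T) \<longleftrightarrow> lattice_connected T"
proof
  let ?X = "cross_dilation r T"
  assume T: "lattice_connected T"
  have arc: "(hub r t, w) \<in> lattice_arcs ?X" if "t \<in> T" "w \<in> nbrs (hub r t)" for t w
    using that hub_in_cross_dilation nbr_in_cross_dilation by (simp add: lattice_arcs_def)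
  have hubs: "(hub r s, hub r t) \<in> (lattice_arcs ?X)\<^sup>*" if "(s, t) \<in> (lattice_arcs T)\<^sup>*" for s t
    using that
  proof induction
    case (step t u)
    then have tu: "t \<in> T" "u \<in> T" "u \<in> nbrs t" by (simp_all add: lattice_arcs_def)
    then have "t \<in> nbrs u" using nbrs_sym by simp
    have "r + t + u \<in> nbrs (hub r t)"
      using tu(3) unfolding in_nbrs_iff hub_def by (simp add: algebra_simps)
    moreover have "r + t + u \<in> nbrs (hub r u)"
      using \<open>t \<in> nbrs u\<close> unfolding in_nbrs_iff hub_def by (simp add: algebra_simps)
    ultimately have "(hub r t, r + t + u) \<in> lattice_arcs ?X" "(r + t + u, hub r u) \<in> lattice_arcs ?X"
      using arc tu symD[OF sym_lattice_arcs] by simp_all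
    with step.IH show ?case by (meson rtrancl.rtrancl_into_rtrancl)
  qed simp
  have to_hub: "\<exists>t\<in>T. (v, hub r t) \<in> (lattice_arcs ?X)\<^sup>*" if "v \<in> ?X" for v
    using that
  proof (cases rule: cross_dilation_cases)
    case (nbr t)
    with arc have "(v, hub r t) \<in> lattice_arcs ?X" using symD[OF sym_lattice_arcs] by simp
    with nbr show ?thesis by blast
  qed blast
  have sym: "sym ((lattice_arcs ?X)\<^sup>*)" by (intro sym_rtrancl sym_lattice_arcs)
  have "(v, w) \<in> (lattice_arcs ?X)\<^sup>*" if "v \<in> ?X" "w \<in> ?X" for v w
  proof -
    obtain s t where "s \<in> T" "t \<in> T" "(v, hub r s) \<in> (lattice_arcs ?X)\<^sup>*"
      "(w, hub r t) \<in> (lattice_arcs ?X)\<^sup>*"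
      using to_hub \<open>v \<in> ?X\<close> \<open>w \<in> ?X\<close> by blast
    moreover from this have "(hub r s, hub r t) \<in> (lattice_arcs ?X)\<^sup>*"
      using T hubs by (simp add: lattice_connected_def)
    ultimately show ?thesis using sym by (meson rtrancl_trans symD)
  qed
  moreover have "?X \<noteq> {}" using T by (simp add: lattice_connected_def cross_dilation_def)
  ultimately show "lattice_connected ?X" by (simp add: lattice_connected_def)
next
  let ?X = "cross_dilation r T"
  assume X: "lattice_connected ?X"
  have "(s, t) \<in> (lattice_arcs T)\<^sup>*" if "s \<in> T" "t \<in> T" for s t
  proof -
    have "(hub r s, hub r t) \<in> (lattice_arcs ?X)\<^sup>*"
      using X that hub_in_cross_dilation by (simp add: lattice_connected_def)
    \<comment> \<open>The condition on u covers walks that end between hubs, as is needed for the induction.\<close>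
    then have "\<forall>u\<in>T. hub r t = hub r u \<or> hub r t \<in> nbrs (hub r u) \<longrightarrow> (s, u) \<in> (lattice_arcs T)\<^sup>*"
    proof induction
      case base
      show ?case using hub_not_nbr_hub by simp
    next
      case (step v w)
      show ?case
      proof (intro ballI impI)
        fix u assume u: "u \<in> T" "w = hub r u \<or> w \<in> nbrs (hub r u)"
        from step(2) have vw: "v \<in> ?X" "w \<in> nbrs v" by (simp_all add: lattice_arcs_def)
        show "(s, u) \<in> (lattice_arcs T)\<^sup>*"
        proof (cases "w = hub r u")
          case True
          with vw have "v \<in> nbrs (hub r u)" using nbrs_sym by simp
          with step.IH u(1) show ?thesis by simp
        next
          case False
          with u have w: "w \<in> nbrs (hub r u)" by simp
          obtain t' where t': "t' \<in> T" "v = hub r t'"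
            using vw(1)
          proof (cases rule: cross_dilation_cases)
            case (nbr t')
            with w vw(2) show ?thesis using nbrs_hubs_not_adjacent by blast
          qed
          then have "(s, t') \<in> (lattice_arcs T)\<^sup>*" using step.IH by simp
          moreover have "u = t' \<or> u \<in> nbrs t'"
            using nbrs_hub_cases w vw(2) t'(2) by blast
          then have "u = t' \<or> (t', u) \<in> lattice_arcs T"
            using t'(1) u(1) by (simp add: lattice_arcs_def)
          ultimately show ?thesis by (meson rtrancl.rtrancl_into_rtrancl)
        qed
      qed
    qed
    with that show ?thesis by blast
  qed
  moreover have "T \<noteq> {}" using X by (simp add: lattice_connected_def cross_dilation_def)
  ultimately show "lattice_connected T" by (simp add: lattice_connected_def)
qed

lemma finite_cross_dilation_iff: "finite (cross_dilation r T) \<longleftrightarrow> finite T"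
proof
  assume "finite (cross_dilation r T)"
  then have "finite (hub r ` T)" by (simp add: cross_dilation_def)
  then show "finite T" by (rule finite_imageD) (simp add: inj_on_def)
qed (simp add: cross_dilation_def)

text \<open>
  With k vertices and e edges in T, the dilation has 5 k - e vertices and 4 k edges. So both are
  trees under the same condition e = k - 1.
\<close>

lemma tree_like_cross_dilation_iff: "tree_like (cross_dilation r T) \<longleftrightarrow> tree_like T"
  using card_cross_dilation[of T r] card_lattice_arcs_cross_dilation[of T r]
  by (auto simp: tree_like_iff lattice_connected_cross_dilation finite_cross_dilation_iff)

lemma card_cross_dilation_tree:
  assumes "tree_like T"
  shows "card (cross_dilation r T) = 4 * card T + 1"
  using card_cross_dilation[of T r] assms by (simp add: tree_like_iff)

lemma crossings_cross_dilation:
  assumes "tree_like T"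
  shows "crossings (cross_dilation r T) = hub r ` T"
proof -
  let ?X = "cross_dilation r T"
  have X: "tree_like ?X" using assms by (simp add: tree_like_cross_dilation_iff)
  have hubs: "hub r ` T \<subseteq> crossings ?X" unfolding crossings_def cross_dilation_def by blast
  moreover have "v \<in> hub r ` T" if "v \<in> crossings ?X" for v
  proof -
    have "v \<in> ?X" using that by (simp add: crossings_def)
    then show ?thesis
    proof (cases rule: cross_dilation_cases)
      case (nbr t)
      then show ?thesis using that hubs not_crossing_if_neighbour(2)[OF X, of "hub r t" v] by blast
    qed blast
  qed
  ultimately show ?thesis by blast
qed

text \<open>
  Hubs have degree 4 and their neighbours at most 2, so no vertex has degree 3. The degree
  count then forces the extremal relation between crossings and vertices of degree 2.
\<close>

lemma saturated_cross_dilation: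
  assumes T: "tree_like T"
  shows "saturated (cross_dilation r T)"
proof -
  let ?X = "cross_dilation r T"
  have X: "tree_like ?X" using T by (simp add: tree_like_cross_dilation_iff)
  have "T \<noteq> {}" "finite T" using T by (auto simp: tree_like_iff lattice_connected_def)
  then have k: "card T > 0" by (simp add: card_gt_0_iff)
  have size: "card ?X = 4 * card T + 1" using T by (rule card_cross_dilation_tree)
  have cr: "card (crossings ?X) = card T"
    by (simp add: crossings_cross_dilation[OF T] card_image inj_on_def)
  have "lattice_degree ?X v \<noteq> 3" if "v \<in> ?X" for v
  proof (cases "v \<in> crossings ?X")
    case True
    then show ?thesis by (simp add: crossings_eq)
  next
    case False
    with that obtain t where "t \<in> T" "v \<in> nbrs (hub r t)"
      using crossings_cross_dilation[OF T, of r] unfolding cross_dilation_def by blast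
    then have "lattice_degree ?X v \<le> 2"
      using not_crossing_if_neighbour(1)[OF X, of "hub r t" v] crossings_cross_dilation[OF T, of r]
      by simp
    then show ?thesis by simp
  qed
  then have "{v \<in> ?X. lattice_degree ?X v = 3} = {}" by blast
  then have "card {v \<in> ?X. lattice_degree ?X v = 3} = 0" by (simp only: card.empty)
  with leaf_count[OF X] degree_partition[OF X] k size cr
  have "card (crossings ?X) = card (links ?X) + 1" by linarith
  with X size k show ?thesis by (simp add: saturated_iff_tight)
qed

lemma saturated_is_cross_dilation:
  assumes "saturated S" "card S = 4 * k + 1" "k \<ge> 1"
  obtains r T where "tree_like T" "card T = k" "S = cross_dilation r T"
proof -
  have S: "tree_like S" "card (crossings S) = card (links S) + 1"
    using assms saturated_iff_tight[of S] by auto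
  then have "crossings S \<noteq> {}" by (metis Suc_eq_plus1 card.empty nat.distinct(1))
  then obtain r where r: "r \<in> crossings S" by blast
  let ?T = "{t. hub r t \<in> crossings S}"
  have eq: "S = cross_dilation r ?T" using tight_is_cross_dilation[OF S r] .
  then have T: "tree_like ?T" using S(1) tree_like_cross_dilation_iff by metis
  moreover have "card ?T = k"
    using card_cross_dilation_tree[OF T, of r] eq assms(2) by simp
  ultimately show ?thesis using that eq by blast
qed

section \<open>Translation classes\<close>

lemma nbrs_translate: "nbrs (v + w) = (\<lambda>p. p + w) ` nbrs v"
  by (simp add: nbrs_def add_ac)

lemma cross_dilation_translate:
  "cross_dilation r ((\<lambda>p. p + v) ` T) = (\<lambda>p. p + (v + v)) ` cross_dilation r T"
proof -
  have "hub r (t + v) = hub r t + (v + v)" for t by (simp add: hub_def add_ac)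
  then show ?thesis
    by (simp only: cross_dilation_def image_Un image_UN image_image nbrs_translate UN_simps)
qed

lemma cross_dilation_base: "cross_dilation r T = (\<lambda>p. p + r) ` cross_dilation 0 T"
proof -
  have "hub r = (\<lambda>t. hub 0 t + r)" by (simp add: hub_def add_ac fun_eq_iff)
  then show ?thesis
    by (simp only: cross_dilation_def image_Un image_UN image_image nbrs_translate)
qed

lemma crossings_translate: "crossings ((\<lambda>p. p + w) ` S) = (\<lambda>p. p + w) ` crossings S"
proof -
  have "(\<lambda>p. p + w) ` A \<subseteq> (\<lambda>p. p + w) ` B \<longleftrightarrow> A \<subseteq> B" for A B :: "(int \<times> int) set"
    by (intro inj_image_subset_iff) (simp add: inj_on_def)
  then have "nbrs (v + w) \<subseteq> (\<lambda>p. p + w) ` S \<longleftrightarrow> nbrs v \<subseteq> S" for v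
    by (simp only: nbrs_translate)
  then show ?thesis unfolding crossings_def by blast
qed

lemma translation_rel_iff: "(S, T) \<in> translation_rel \<longleftrightarrow> (\<exists>v. T = (\<lambda>p. p + v) ` S)"
  by (simp only: translation_rel_def mem_Collect_eq case_prod_conv)

text \<open>
  The crossings of a dilation are its hubs, so a translation between two dilations maps hubs to hubs;
  its vector is therefore even, and half of it translates the original sets.
\<close>

lemma cross_dilation_translation_rel:
  assumes S: "tree_like S" and T: "tree_like T"
  shows "(cross_dilation 0 S, cross_dilation 0 T) \<in> translation_rel \<longleftrightarrow> (S, T) \<in> translation_rel"
proof
  assume "(S, T) \<in> translation_rel"
  then show "(cross_dilation 0 S, cross_dilation 0 T) \<in> translation_rel"
    unfolding translation_rel_iff using cross_dilation_translate by metis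
next
  assume "(cross_dilation 0 S, cross_dilation 0 T) \<in> translation_rel"
  then obtain w where "cross_dilation 0 T = (\<lambda>p. p + w) ` cross_dilation 0 S"
    unfolding translation_rel_iff by blast
  then have hubs: "hub 0 ` T = (\<lambda>p. p + w) ` hub 0 ` S"
    using crossings_cross_dilation[OF S, of 0] crossings_cross_dilation[OF T, of 0]
      crossings_translate by metis
  have "S \<noteq> {}" using S by (auto simp: tree_like_iff lattice_connected_def)
  then obtain s where "s \<in> S" by blast
  then have "hub 0 s + w \<in> hub 0 ` T" unfolding hubs by blast
  then obtain t where "hub 0 t = hub 0 s + w" by (metis imageE)
  \<comment> \<open>Hubs with the same origin differ by even vectors.\<close>
  then have w: "w = (t - s) + (t - s)" by (simp add: hub_def algebra_simps)
  have "hub 0 x + w = hub 0 (x + (t - s))" for x by (simp add: w hub_def algebra_simps)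
  then have "hub 0 ` T = hub 0 ` (\<lambda>p. p + (t - s)) ` S"
    using hubs by (simp add: image_image)
  then have "T = (\<lambda>p. p + (t - s)) ` S"
    by (subst (asm) inj_image_eq_iff) (simp_all add: inj_on_def)
  then show "(S, T) \<in> translation_rel" unfolding translation_rel_iff by blast
qed

text \<open>
  In the map on classes, f is applied to those representatives of C that lie in A, since the classes
  of a quotient A // r need not be contained in A.
\<close>

lemma bij_betw_quotients:
  assumes r: "equiv UNIV r" and maps: "f ` A \<subseteq> B"
    and rel: "\<And>x y. x \<in> A \<Longrightarrow> y \<in> A \<Longrightarrow> (f x, f y) \<in> r \<longleftrightarrow> (x, y) \<in> r"
    and onto: "\<And>y. y \<in> B \<Longrightarrow> \<exists>x\<in>A. (f x, y) \<in> r"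
  shows "bij_betw (\<lambda>C. r `` (f ` (C \<inter> A))) (A // r) (B // r)"
proof -
  note eq_iff = eq_equiv_class_iff[OF r UNIV_I UNIV_I]
  have class_image: "r `` (f ` (r `` {x} \<inter> A)) = r `` {f x}" if "x \<in> A" for x
  proof
    show "r `` {f x} \<subseteq> r `` (f ` (r `` {x} \<inter> A))"
      using that equiv_class_self[OF r UNIV_I, of x] by blast
    show "r `` (f ` (r `` {x} \<inter> A)) \<subseteq> r `` {f x}"
    proof
      fix z assume "z \<in> r `` (f ` (r `` {x} \<inter> A))"
      then obtain y where "(x, y) \<in> r" "y \<in> A" "(f y, z) \<in> r" by blast
      with rel that have "(f x, f y) \<in> r" by blast
      with \<open>(f y, z) \<in> r\<close> show "z \<in> r `` {f x}"
        using r by (auto simp: equiv_def dest: transD)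
    qed
  qed
  show ?thesis
    unfolding bij_betw_def
  proof
    show "inj_on (\<lambda>C. r `` (f ` (C \<inter> A))) (A // r)"
      by (auto simp: inj_on_def quotient_def class_image eq_iff rel)
    have "(\<lambda>C. r `` (f ` (C \<inter> A))) ` (A // r) = (\<lambda>x. r `` {f x}) ` A"
      by (auto simp: quotient_def class_image image_iff)
    also have "\<dots> = B // r"
    proof
      show "(\<lambda>x. r `` {f x}) ` A \<subseteq> B // r" using maps by (auto simp: quotient_def)
      show "B // r \<subseteq> (\<lambda>x. r `` {f x}) ` A"
        using onto by (fastforce simp: quotient_def eq_iff[symmetric])
    qed
    finally show "(\<lambda>C. r `` (f ` (C \<inter> A))) ` (A // r) = B // r" .
  qed
qed

theorem theorem6p4:
  fixes k :: nat
  assumes "k \<ge> 1"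
  shows "\<exists>\<phi>. bij_betw \<phi> (tree_like_polyominoes k) (saturated_polyominoes (4 * k + 1))"
  unfolding tree_like_polyominoes_def saturated_polyominoes_def
proof (intro exI, rule bij_betw_quotients[OF equiv_translation_rel])
  show "cross_dilation 0 ` {S. tree_like S \<and> card S = k} \<subseteq> {S. saturated S \<and> card S = 4 * k + 1}"
    by (auto simp: saturated_cross_dilation card_cross_dilation_tree)
  show "(cross_dilation 0 S, cross_dilation 0 T) \<in> translation_rel \<longleftrightarrow> (S, T) \<in> translation_rel"
    if "S \<in> {S. tree_like S \<and> card S = k}" "T \<in> {S. tree_like S \<and> card S = k}" for S T
    using that by (simp add: cross_dilation_translation_rel)
  show "\<exists>T\<in>{S. tree_like S \<and> card S = k}. (cross_dilation 0 T, S) \<in> translation_rel"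
    if S: "S \<in> {S. saturated S \<and> card S = 4 * k + 1}" for S
  proof -
    obtain r T where T: "tree_like T" "card T = k" "S = cross_dilation r T"
      using saturated_is_cross_dilation[of S k] S assms by blast
    \<comment> \<open>Changing the origin of a dilation only translates it.\<close>
    have "(cross_dilation 0 T, S) \<in> translation_rel"
      unfolding T(3) cross_dilation_base[of r] translation_rel_iff by blast
    with T show ?thesis by blast
  qed
qed

end
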